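(* Let $\alpha,\beta>0$ with $\beta\neq\alpha$, and let $\delta=\alpha$, $\gamma=\beta$ (the deltoid I). The set of all configurations $(x,y,z,w)\in(\mathbb{R}\cup\{\infty\})^4$ of the planar 4-bar linkage with bar lengths $\alpha,\beta,\gamma,\delta$ is the union of the following two branches, each diffeomorphic to a circle $S^1$: (1) $\left\{\left(x,\ \dfrac{(\beta-\alpha)x^2+(\beta+\alpha)}{2\alpha x},\ x,\ \dfrac{(\alpha-\beta)x^2+(\alpha+\beta)}{2\beta x}\right) : x\in\mathbb{R}\cup\{\infty\}\right\}$, where the second and fourth entries are understood to be $\infty$ when $x=0$ or $x=\infty$; (2) $\{(x,\,\infty,\,-x,\,\infty) : x\in\mathbb{R}\cup\{\infty\}\}$.
   Context: $\mathbb{R}\cup\{\infty\}$ is the one-point compactification of $\mathbb{R}$, with $-\infty=\infty$. A planar 4-bar linkage has bar lengths $\alpha,\beta,\gamma,\delta>0$ in counter-clockwise cyclic order. Its configurations are described by rotational angles $\rho_x,\rho_y,\rho_z,\rho_w\in\mathbb{R}/2\pi\mathbb{Z}$, the (exterior) turning angles from bar $\alpha$ to $\beta$, from $\beta$ to $\gamma$, from $\gamma$ to $\delta$, and from $\delta$ to $\alpha$, respectively, when the closed quadrilateral is traversed once. Thus a quadruple of angles is a configuration if and only if $\rho_x+\rho_y+\rho_z+\rho_w\equiv 0 \pmod{2\pi}$ and $\beta+\gamma e^{i\rho_y}+\delta e^{i(\rho_y+\rho_z)}+\alpha e^{i(\rho_y+\rho_z+\rho_w)}=0$ (self-intersections and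 overlaps of bars are allowed). One writes $x=\tan\frac{\rho_x}{2}$, $y=\tan\frac{\rho_y}{2}$, $z=\tan\frac{\rho_z}{2}$, $w=\tan\frac{\rho_w}{2}$, with value $\infty$ when the angle is $\pi$, and identifies a configuration with $(x,y,z,w)\in(\mathbb{R}\cup\{\infty\})^4$. *)

theory Defs
  imports "HOL-Analysis.Analysis" "HOL-Library.Real_Mod"
begin

section \<open>Smooth maps and diffeomorphisms\<close>

text \<open>
  Iterated Frechet differentiability on an open set. In finite dimension, the derivative is a
  \<open>C\<^sup>k\<close> map iff each of its directional components is, which avoids a change of codomain type.
\<close>

primrec Ck_on :: "nat \<Rightarrow> 'a::euclidean_space set \<Rightarrow> ('a \<Rightarrow> 'b::euclidean_space) \<Rightarrow> bool" where
  "Ck_on 0 W f \<longleftrightarrow> continuous_on W f"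
| "Ck_on (Suc k) W f \<longleftrightarrow>
     (\<forall>x\<in>W. f differentiable (at x)) \<and> (\<forall>v. Ck_on k W (\<lambda>x. frechet_derivative f (at x) v))"

definition Cinf_on :: "'a::euclidean_space set \<Rightarrow> ('a \<Rightarrow> 'b::euclidean_space) \<Rightarrow> bool" where
  "Cinf_on W f \<longleftrightarrow> (\<forall>k. Ck_on k W f)"

text \<open>A chart is a coordinate domain together with a coordinate map (relevant only on the domain).\<close>

type_synonym ('a, 'e) atlas = "('a set \<times> ('a \<Rightarrow> 'e)) set"

definition euclidean_atlas :: "('e::euclidean_space, 'e) atlas" where
  "euclidean_atlas = {(UNIV, \<lambda>x. x)}"

definition prod_atlas :: "('a, 'e) atlas \<Rightarrow> ('b, 'f) atlas \<Rightarrow> ('a \<times> 'b, 'e \<times> 'f) atlas" where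
  "prod_atlas \<A> \<B> = {(U \<times> V, map_prod \<phi> \<psi>) | U V \<phi> \<psi>. (U, \<phi>) \<in> \<A> \<and> (V, \<psi>) \<in> \<B>}"

text \<open>
  Smoothness on an arbitrary subset \<open>X\<close> of a manifold: near each point of \<open>X\<close>, the coordinate
  expression of the map is the restriction of a smooth map defined on an open set of the ambient
  coordinate space. With this notion, a subset \<open>X\<close> is diffeomorphic to a manifold \<open>Y\<close> iff it is
  an embedded submanifold of its ambient manifold which is diffeomorphic to \<open>Y\<close>.
\<close>

definition smooth_map_on ::
  "('a, 'e::euclidean_space) atlas \<Rightarrow> 'a set \<Rightarrow> ('b, 'f::euclidean_space) atlas \<Rightarrow> ('a \<Rightarrow> 'b) \<Rightarrow> bool"
  where
  "smooth_map_on \<A> X \<B> f \<longleftrightarrow>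
     (\<forall>p\<in>X. \<exists>(U, \<phi>)\<in>\<A>. \<exists>(V, \<psi>)\<in>\<B>. p \<in> U \<and> f p \<in> V \<and>
        (\<exists>W g. open W \<and> \<phi> p \<in> W \<and> W \<subseteq> \<phi> ` U \<and> Cinf_on W g \<and>
           (\<forall>q\<in>X \<inter> U. \<phi> q \<in> W \<longrightarrow> f q \<in> V \<and> \<psi> (f q) = g (\<phi> q))))"

definition diffeomorphic ::
  "('a, 'e::euclidean_space) atlas \<Rightarrow> 'a set \<Rightarrow> ('b, 'f::euclidean_space) atlas \<Rightarrow> 'b set \<Rightarrow> bool"
  where
  "diffeomorphic \<A> X \<B> Y \<longleftrightarrow>
     (\<exists>f g. smooth_map_on \<A> X \<B> f \<and> smooth_map_on \<B> Y \<A> g \<and>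
        f ` X \<subseteq> Y \<and> g ` Y \<subseteq> X \<and> (\<forall>x\<in>X. g (f x) = x) \<and> (\<forall>y\<in>Y. f (g y) = y))"


section \<open>The one-point compactification of the real line\<close>

text \<open>
  \<open>None\<close> plays the role of \<open>\<infinity>\<close>, as in \<^const>\<open>Alexandroff_compactification\<close>. The negation
  \<open>map_option uminus\<close> fixes it.
\<close>

type_synonym rext = "real option"

fun inf_chart :: "rext \<Rightarrow> real" where
  "inf_chart None = 0"
| "inf_chart (Some t) = 1 / t"

text \<open>
  The standard smooth structure (that of the real projective line), with the coordinates \<open>x\<close> and
  \<open>1 / x\<close>. It is the one that makes \<open>\<rho> \<mapsto> tan (\<rho> / 2)\<close> a diffeomorphism from
  \<open>\<real> / 2\<pi>\<int>\<close>.
\<close>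

definition rext_atlas :: "(rext, real) atlas" where
  "rext_atlas = {(- {None}, the), (- {Some 0}, inf_chart)}"

text \<open>The topology induced by the two charts is that of the one-point compactification.\<close>

lemma openin_rext_iff_charts:
  "openin (Alexandroff_compactification euclidean) S \<longleftrightarrow>
     (\<forall>(U, \<phi>)\<in>rext_atlas. open (\<phi> ` (S \<inter> U)))"
proof -
  define T where "T = {t. Some t \<in> S}"
  define R where "R = {s. s \<noteq> 0 \<and> 1 / s \<in> T}"
  have im1: "the ` (S \<inter> - {None}) = T"
    by (force simp: T_def image_iff)
  have im2: "inf_chart ` (S \<inter> - {Some 0}) = R \<union> (if None \<in> S then {0} else {})"
  proof (rule set_eqI)
    fix s
    show "s \<in> inf_chart ` (S \<inter> - {Some 0}) \<longleftrightarrow> s \<in> R \<union> (if None \<in> S then {0} else {})"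
    proof
      assume "s \<in> inf_chart ` (S \<inter> - {Some 0})"
      then obtain x where x: "x \<in> S" "x \<noteq> Some 0" "s = inf_chart x" by auto
      then show "s \<in> R \<union> (if None \<in> S then {0} else {})"
        by (cases x) (auto simp: R_def T_def)
    next
      assume s: "s \<in> R \<union> (if None \<in> S then {0} else {})"
      show "s \<in> inf_chart ` (S \<inter> - {Some 0})"
      proof (cases "s = 0")
        case True
        with s have "None \<in> S" by (auto simp: R_def split: if_splits)
        then show ?thesis using True by (intro image_eqI[of _ _ None]) auto
      next
        case False
        with s show ?thesis
          by (intro image_eqI[of _ _ "Some (1 / s)"]) (auto simp: R_def T_def split: if_splits)
      qed
    qed
  qed
  have R: "open R" if "open T"
  proof -
    have "open (- {0} \<inter> (\<lambda>s::real. 1 / s) -` T)"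
      by (intro continuous_open_preimage that continuous_intros) auto
    moreover have "- {0} \<inter> (\<lambda>s::real. 1 / s) -` T = R"
      by (auto simp: R_def)
    ultimately show ?thesis by simp
  qed
  have rhs: "(\<forall>(U, \<phi>)\<in>rext_atlas. open (\<phi> ` (S \<inter> U))) \<longleftrightarrow>
      open T \<and> open (R \<union> (if None \<in> S then {0} else {}))"
    by (simp add: rext_atlas_def im1 im2)
  show ?thesis
  proof (cases "None \<in> S")
    case False
    then have "S = Some ` T"
      unfolding set_eq_iff by (simp add: T_def image_iff split_option_all)
    then have "openin (Alexandroff_compactification euclidean) S \<longleftrightarrow> open T"
      by simp
    then show ?thesis using rhs R False by auto
  next
    case True
    then have S: "S = insert None (Some ` T)"
      unfolding set_eq_iff by (simp add: T_def image_iff split_option_all)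
    have lhs: "openin (Alexandroff_compactification euclidean) S \<longleftrightarrow> compact (- T)"
    proof
      assume "openin (Alexandroff_compactification euclidean) S"
      then obtain C where C: "compact C" "S = insert None (Some ` (- C))"
        using True by (auto simp: openin_Alexandroff_compactification Compl_eq_Diff_UNIV)
      then have "- T = C" by (auto simp: T_def)
      with C show "compact (- T)" by simp
    next
      assume c: "compact (- T)"
      then have "S = insert None (Some ` (UNIV - (- T)))" using S by auto
      then show "openin (Alexandroff_compactification euclidean) S"
        using c by (auto simp: openin_Alexandroff_compactification compact_imp_closed simp del: Diff_UNIV)
    qed
    have "bounded (- T) \<longleftrightarrow> open (insert 0 R)" if T: "open T"
    proof
      assume "bounded (- T)"
      then obtain B where B: "B > 0" "\<And>t. t \<notin> T \<Longrightarrow> \<bar>t\<bar> \<le> B"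
        by (auto simp: bounded_pos)
      have "s \<in> insert 0 R" if "\<bar>s\<bar> < 1 / B" for s
      proof (cases "s = 0")
        case False
        then have "\<bar>1 / s\<bar> > B"
          using that B(1) by (simp add: field_simps)
        then show ?thesis using B(2)[of "1 / s"] False by (auto simp: R_def)
      qed auto
      then have "ball 0 (1 / B) \<subseteq> insert 0 R"
        unfolding subset_iff mem_ball_0 real_norm_def by blast
      then have "insert 0 R = R \<union> ball 0 (1 / B)" using B(1) by auto
      then show "open (insert 0 R)" using R[OF T] by (metis open_Un open_ball)
    next
      assume "open (insert 0 R)"
      then obtain e where e: "e > 0" "ball 0 e \<subseteq> insert 0 R"
        by (meson insertI1 open_contains_ball)
      have "\<bar>t\<bar> \<le> 1 / e" if "t \<notin> T" for t
      proof (rule ccontr)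
        assume h: "\<not> \<bar>t\<bar> \<le> 1 / e"
        then have t: "t \<noteq> 0" using e(1) by auto
        then have "\<bar>1 / t\<bar> < e" using h e(1) by (simp add: field_simps)
        then have "1 / t \<in> insert 0 R" using subsetD[OF e(2), of "1 / t"] by simp
        then show False using t that by (auto simp: R_def)
      qed
      then show "bounded (- T)" by (auto simp: bounded_iff)
    qed
    then show ?thesis
      using rhs lhs True by (auto simp: compact_eq_bounded_closed closed_def)
  qed
qed

definition rext4_atlas :: "(rext \<times> rext \<times> rext \<times> rext, real \<times> real \<times> real \<times> real) atlas" where
  "rext4_atlas = prod_atlas rext_atlas (prod_atlas rext_atlas (prod_atlas rext_atlas rext_atlas))"

abbreviation diffeomorphic_circle :: "(rext \<times> rext \<times> rext \<times> rext) set \<Rightarrow> bool" where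
  "diffeomorphic_circle B \<equiv>
     diffeomorphic rext4_atlas B euclidean_atlas (sphere (0::complex) 1)"


section \<open>Planar 4-bar linkages\<close>

text \<open>Angles in \<open>\<real> / 2\<pi>\<int>\<close> are given by real representatives.\<close>

definition half_tan :: "real \<Rightarrow> rext" where
  "half_tan \<rho> = (if [\<rho> = pi] (rmod (2 * pi)) then None else Some (tan (\<rho> / 2)))"

definition is_angle_config ::
  "real \<Rightarrow> real \<Rightarrow> real \<Rightarrow> real \<Rightarrow> real \<Rightarrow> real \<Rightarrow> real \<Rightarrow> real \<Rightarrow> bool" where
  "is_angle_config \<alpha> \<beta> \<gamma> \<delta> \<rho>x \<rho>y \<rho>z \<rho>w \<longleftrightarrow>
     [\<rho>x + \<rho>y + \<rho>z + \<rho>w = 0] (rmod (2 * pi)) \<and>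
     of_real \<beta> + of_real \<gamma> * cis \<rho>y + of_real \<delta> * cis (\<rho>y + \<rho>z)
       + of_real \<alpha> * cis (\<rho>y + \<rho>z + \<rho>w) = 0"

definition configurations ::
  "real \<Rightarrow> real \<Rightarrow> real \<Rightarrow> real \<Rightarrow> (rext \<times> rext \<times> rext \<times> rext) set" where
  "configurations \<alpha> \<beta> \<gamma> \<delta> =
     {(half_tan \<rho>x, half_tan \<rho>y, half_tan \<rho>z, half_tan \<rho>w) | \<rho>x \<rho>y \<rho>z \<rho>w.
        is_angle_config \<alpha> \<beta> \<gamma> \<delta> \<rho>x \<rho>y \<rho>z \<rho>w}"

text \<open>
  \<open>deltoid_coord a b x\<close> is \<open>((b - a) x\<^sup>2 + (b + a)) / (2 a x)\<close>; the second and the fourth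
  coordinate of the first branch differ by exchanging the two bar lengths.
\<close>

fun deltoid_coord :: "real \<Rightarrow> real \<Rightarrow> rext \<Rightarrow> rext" where
  "deltoid_coord a b None = None"
| "deltoid_coord a b (Some x) =
     (if x = 0 then None else Some (((b - a) * x\<^sup>2 + (b + a)) / (2 * a * x)))"

definition deltoid_branch1 :: "real \<Rightarrow> real \<Rightarrow> (rext \<times> rext \<times> rext \<times> rext) set" where
  "deltoid_branch1 \<alpha> \<beta> =
     {(x, deltoid_coord \<alpha> \<beta> x, x, deltoid_coord \<beta> \<alpha> x) | x. x \<in> UNIV}"

definition deltoid_branch2 :: "(rext \<times> rext \<times> rext \<times> rext) set" where
  "deltoid_branch2 = {(x, None, map_option uminus x, None) | x. x \<in> UNIV}"

end

(* With the rotations a, b, c, d = cis rho_x, ..., cis rho_w, a deltoid configuration is a solution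
   of a b c d = 1 and beta (1 + b) + alpha (b c + 1/a) = 0. Comparing the last equation with its
   conjugate gives (c - a)(a b c + 1) = 0. If c = a, then b and d are determined by a, since
   beta + alpha a and alpha + beta a cannot vanish for alpha, beta distinct; if a b c = -1, then
   d = -1, so b = -1 and c = 1/a. The half-angle tangent is the inverse of the Cayley transform.

   Both branches are graphs over the first coordinate, which the Cayley transform identifies with
   the unit circle. On the circle every coordinate is a ratio [p : q] of smooth functions without
   common zeros, at least locally, and such a ratio is a smooth map to the projective line. *)

theory Submission
  imports Defs
begin

section \<open>Closure properties of smooth functions\<close>

text \<open>A derivative depends only on a neighbourhood, so agreement on an open set gives the same
  derivatives at its points; \<open>frechet_derivative\<close>, chosen by that property, then agrees
  as well.\<close>

lemma Ck_on_cong: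
  assumes "open W" "\<And>x. x \<in> W \<Longrightarrow> f x = g x"
  shows "Ck_on k W f \<longleftrightarrow> Ck_on k W g"
  using assms(2)
proof (induction k arbitrary: f g)
  case 0
  then show ?case
    by (simp cong: continuous_on_cong)
next
  case (Suc k)
  have D: "(f has_derivative D) (at x) \<longleftrightarrow> (g has_derivative D) (at x)" if "x \<in> W" for x D
    using has_derivative_transform_within_open[OF _ \<open>open W\<close> that, of f D UNIV g]
      has_derivative_transform_within_open[OF _ \<open>open W\<close> that, of g D UNIV f] Suc.prems
    by auto
  then have "frechet_derivative f (at x) = frechet_derivative g (at x)" if "x \<in> W" for x
    using that by (simp add: frechet_derivative_def)
  then have "Ck_on k W (\<lambda>x. frechet_derivative f (at x) v)
      \<longleftrightarrow> Ck_on k W (\<lambda>x. frechet_derivative g (at x) v)" for v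
    by (intro Suc.IH) simp
  then show ?case
    using D by (simp add: differentiable_def)
qed

text \<open>Lets any known derivative formula stand in for the chosen
  \<open>frechet_derivative\<close>; the closure rules below raise the order through it.\<close>

lemma Ck_on_SucI:
  assumes "open W" "\<And>x. x \<in> W \<Longrightarrow> (f has_derivative D x) (at x)"
    "\<And>v. Ck_on k W (\<lambda>x. D x v)"
  shows "Ck_on (Suc k) W f"
proof -
  have "Ck_on k W (\<lambda>x. frechet_derivative f (at x) v) \<longleftrightarrow> Ck_on k W (\<lambda>x. D x v)" for v
    using assms(1) by (rule Ck_on_cong) (simp add: frechet_derivative_at[OF assms(2), symmetric])
  then show ?thesis
    using assms(2,3) by (auto simp: differentiable_def)
qed

lemma Ck_on_SucD:
  assumes "Ck_on (Suc k) W f"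
  shows "x \<in> W \<Longrightarrow> (f has_derivative frechet_derivative f (at x)) (at x)"
    and "Ck_on k W (\<lambda>x. frechet_derivative f (at x) v)"
  using assms by (auto simp: frechet_derivative_works)

lemma Ck_on_Suc_imp:
  "Ck_on (Suc k) W f \<Longrightarrow> Ck_on k W f"
proof (induction k arbitrary: f)
  case 0
  then show ?case
    by (auto intro!: continuous_at_imp_continuous_on differentiable_imp_continuous_within)
next
  case (Suc k)
  then show ?case
    by (metis Ck_on.simps(2))
qed

lemma Ck_on_const: "open W \<Longrightarrow> Ck_on k W (\<lambda>x. c)"
proof (induction k arbitrary: c)
  case (Suc k)
  show ?case
    by (rule Ck_on_SucI[OF Suc.prems has_derivative_const Suc.IH[OF Suc.prems]])
qed simp

lemma Ck_on_bounded_linear: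
  assumes "open W" "bounded_linear L"
  shows "Ck_on k W L"
proof (cases k)
  case 0
  then show ?thesis using assms by (simp add: linear_continuous_on)
next
  case (Suc n)
  show ?thesis unfolding Suc
    by (rule Ck_on_SucI[where D = "\<lambda>_. L"])
      (auto intro: bounded_linear_imp_has_derivative Ck_on_const assms)
qed

lemma Ck_on_add:
  assumes "open W" "Ck_on k W f" "Ck_on k W g"
  shows "Ck_on k W (\<lambda>x. f x + g x)"
  using assms(2,3)
proof (induction k arbitrary: f g)
  case (Suc k)
  note f = Suc.prems(1) and g = Suc.prems(2)
  show ?case
    by (rule Ck_on_SucI[OF assms(1) has_derivative_add[OF Ck_on_SucD(1)[OF f] Ck_on_SucD(1)[OF g]]])
      (assumption | rule f g Suc.IH Ck_on_SucD(2))+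
qed (auto intro: continuous_intros)

text \<open>The product rule gives a sum of two terms of the same bilinear shape, each pairing one
  function with a derivative of the other. The induction hypothesis covers both once the underived
  factor is lowered by one order.\<close>

lemma Ck_on_bilinear:
  fixes f :: "'a::euclidean_space \<Rightarrow> 'b::euclidean_space" and g :: "'a \<Rightarrow> 'c::euclidean_space"
    and m :: "'b \<Rightarrow> 'c \<Rightarrow> 'd::euclidean_space"
  assumes "open W" "bounded_bilinear m" "Ck_on k W f" "Ck_on k W g"
  shows "Ck_on k W (\<lambda>x. m (f x) (g x))"
  using assms(3,4)
proof (induction k arbitrary: f g)
  case 0
  then show ?case by (auto intro: bounded_bilinear.continuous_on[OF assms(2)])
next
  case (Suc k)
  note f = Suc.prems(1) and g = Suc.prems(2)
  show ?case
    by (rule Ck_on_SucI[OF assms(1) bounded_bilinear.FDERIV[OF assms(2) Ck_on_SucD(1)[OF f] Ck_on_SucD(1)[OF g]]])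
      (assumption | rule f g Ck_on_add[OF assms(1)] Suc.IH Ck_on_SucD(2) Ck_on_Suc_imp)+
qed

text \<open>The derivative in direction v is -(1/f) f'(v) (1/f), built from f'(v) and from 1/f
  itself, which is smooth to the lower order by induction.\<close>

lemma Ck_on_inverse:
  fixes f :: "'a::euclidean_space \<Rightarrow> 'b::{euclidean_space, real_normed_div_algebra}"
  assumes "open W" "Ck_on k W f" "\<And>x. x \<in> W \<Longrightarrow> f x \<noteq> 0"
  shows "Ck_on k W (\<lambda>x. inverse (f x))"
  using assms(2)
proof (induction k)
  case 0
  then show ?case using assms(3) by (auto intro: continuous_intros)
next
  case (Suc k)
  note mult = Ck_on_bilinear[OF assms(1) bounded_bilinear_mult]
    and D = Ck_on_SucD[OF Suc.prems]
  have I: "Ck_on k W (\<lambda>x. inverse (f x))"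
    by (rule Suc.IH[OF Ck_on_Suc_imp[OF Suc.prems]])
  \<comment> \<open>Negation is written as scaling by -1, so that the bilinear rule covers
    it.\<close>
  have "Ck_on k W (\<lambda>x. (-1) *\<^sub>R (inverse (f x) * frechet_derivative f (at x) v * inverse (f x)))" for v
    by (rule Ck_on_bilinear[OF assms(1) bounded_bilinear_scaleR Ck_on_const[OF assms(1)] mult[OF mult[OF I D(2)] I]])
  then have N: "Ck_on k W (\<lambda>x. - (inverse (f x) * frechet_derivative f (at x) v * inverse (f x)))" for v
    by simp
  show ?case
    by (rule Ck_on_SucI[OF assms(1) Deriv.has_derivative_inverse[OF assms(3) D(1)]]) (assumption | rule N)+
qed

lemma Ck_on_linear_comp:
  assumes "open W" "bounded_linear L" "Ck_on k W f"
  shows "Ck_on k W (\<lambda>x. L (f x))"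
  using assms(3)
proof (induction k arbitrary: f)
  case 0
  then show ?case by (auto intro: bounded_linear.continuous_on[OF assms(2)])
next
  case (Suc k)
  show ?case
    by (rule Ck_on_SucI[OF assms(1) bounded_linear.has_derivative[OF assms(2) Ck_on_SucD(1)[OF Suc.prems]]])
      (assumption | rule Suc.prems Suc.IH Ck_on_SucD(2))+
qed

text \<open>For a linear inner map the chain rule stays within the induction: the derivative in
  direction v is that of f in the fixed direction L v, again composed with L. The later use is for
  the projection \<open>fst\<close>.\<close>

lemma Ck_on_comp_linear:
  assumes "open W" "bounded_linear L" "Ck_on k W f"
  shows "Ck_on k (L -` W) (\<lambda>x. f (L x))"
  using assms(3)
proof (induction k arbitrary: f)
  case 0
  then show ?case
    by (auto intro!: continuous_on_compose2[OF _ linear_continuous_on[OF assms(2)]])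
next
  case (Suc k)
  show ?case
  proof (rule Ck_on_SucI)
    show "open (L -` W)"
      using assms(1,2) by (simp add: linear_continuous_on open_vimage)
    show "((\<lambda>x. f (L x)) has_derivative (\<lambda>v. frechet_derivative f (at (L x)) (L v))) (at x)"
      if "x \<in> L -` W" for x
      using that Ck_on_SucD(1)[OF Suc.prems]
      by (intro has_derivative_compose[OF bounded_linear_imp_has_derivative[OF assms(2)]]) auto
    show "Ck_on k (L -` W) (\<lambda>x. frechet_derivative f (at (L x)) (L v))" for v
      by (rule Suc.IH[OF Ck_on_SucD(2)[OF Suc.prems]])
  qed
qed

section \<open>Rules for smoothness of all orders\<close>

named_theorems Cinf_intros

lemma Cinf_on_const [Cinf_intros]: "open W \<Longrightarrow> Cinf_on W (\<lambda>x. c)"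
  by (simp add: Cinf_on_def Ck_on_const)

lemma Cinf_on_bounded_linear: "open W \<Longrightarrow> bounded_linear L \<Longrightarrow> Cinf_on W L"
  by (simp add: Cinf_on_def Ck_on_bounded_linear)

lemma Cinf_on_ident [Cinf_intros]: "open W \<Longrightarrow> Cinf_on W (\<lambda>x. x)"
  by (simp add: Cinf_on_bounded_linear bounded_linear_ident)

lemma Cinf_on_linear_comp:
  "open W \<Longrightarrow> bounded_linear L \<Longrightarrow> Cinf_on W f \<Longrightarrow> Cinf_on W (\<lambda>x. L (f x))"
  by (simp add: Cinf_on_def Ck_on_linear_comp)

lemmas Cinf_on_Re [Cinf_intros] = Cinf_on_linear_comp[OF _ bounded_linear_Re]
lemmas Cinf_on_Im [Cinf_intros] = Cinf_on_linear_comp[OF _ bounded_linear_Im]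
lemmas Cinf_on_of_real [Cinf_intros] = Cinf_on_linear_comp[OF _ bounded_linear_of_real]
lemmas Cinf_on_minus [Cinf_intros] = Cinf_on_linear_comp[OF _ bounded_linear_minus[OF bounded_linear_ident]]

lemma Cinf_on_add [Cinf_intros]:
  "open W \<Longrightarrow> Cinf_on W f \<Longrightarrow> Cinf_on W g \<Longrightarrow> Cinf_on W (\<lambda>x. f x + g x)"
  by (simp add: Cinf_on_def Ck_on_add)

lemma Cinf_on_diff [Cinf_intros]:
  "open W \<Longrightarrow> Cinf_on W f \<Longrightarrow> Cinf_on W g \<Longrightarrow> Cinf_on W (\<lambda>x. f x - g x)"
  using Cinf_on_add[OF _ _ Cinf_on_minus, of W f g] by simp

lemma Cinf_on_mult [Cinf_intros]:
  fixes f g :: "'a::euclidean_space \<Rightarrow> 'b::{euclidean_space, real_normed_algebra}"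
  shows "open W \<Longrightarrow> Cinf_on W f \<Longrightarrow> Cinf_on W g \<Longrightarrow> Cinf_on W (\<lambda>x. f x * g x)"
  by (simp add: Cinf_on_def Ck_on_bilinear[OF _ bounded_bilinear_mult])

lemma Cinf_on_divide [Cinf_intros]:
  fixes f g :: "'a::euclidean_space \<Rightarrow> 'b::{euclidean_space, real_normed_field}"
  assumes "open W" "Cinf_on W f" "Cinf_on W g" "\<And>x. x \<in> W \<Longrightarrow> g x \<noteq> 0"
  shows "Cinf_on W (\<lambda>x. f x / g x)"
proof -
  have "Cinf_on W (\<lambda>x. inverse (g x))"
    using assms unfolding Cinf_on_def by (blast intro: Ck_on_inverse)
  then show ?thesis
    unfolding divide_inverse using assms by (intro Cinf_on_mult)
qed

lemma Cinf_on_Pair [Cinf_intros]: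
  assumes "open W" "Cinf_on W f" "Cinf_on W g"
  shows "Cinf_on W (\<lambda>x. (f x, g x))"
proof -
  \<comment> \<open>The pair is the sum of the images of its components under the two linear
    embeddings of the factors.\<close>
  have "Cinf_on W (\<lambda>x. (f x, 0) + (0, g x))"
    by (intro Cinf_on_add assms
        Cinf_on_linear_comp[of W "\<lambda>a. (a, 0)"] Cinf_on_linear_comp[of W "\<lambda>b. (0, b)"]
        bounded_linear_Pair bounded_linear_ident bounded_linear_zero)
  then show ?thesis by simp
qed

lemma Cinf_on_subset:
  assumes "open V" "V \<subseteq> W" "Cinf_on W f"
  shows "Cinf_on V f"
proof -
  have "Ck_on k W f \<Longrightarrow> Ck_on k V f" for k
  proof (induction k arbitrary: f)
    case 0
    then show ?case using assms(2) by (auto intro: continuous_on_subset)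
  next
    case (Suc k)
    then show ?case using assms(2) by (simp add: subset_iff)
  qed
  then show ?thesis
    using assms(3) by (simp add: Cinf_on_def)
qed

section \<open>Smooth maps between products\<close>

lemma smooth_map_on_Pair:
  assumes f: "smooth_map_on euclidean_atlas X \<A> f"
    and g: "smooth_map_on euclidean_atlas X \<B> g"
  shows "smooth_map_on euclidean_atlas X (prod_atlas \<A> \<B>) (\<lambda>x. (f x, g x))"
  unfolding smooth_map_on_def
proof
  fix p assume p: "p \<in> X"
  obtain V \<psi> W f' where 1: "(V, \<psi>) \<in> \<A>" "f p \<in> V" "open W" "p \<in> W" "Cinf_on W f'"
    "\<And>q. q \<in> X \<Longrightarrow> q \<in> W \<Longrightarrow> f q \<in> V \<and> \<psi> (f q) = f' q"
    using f p by (force simp: smooth_map_on_def euclidean_atlas_def)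
  obtain V' \<psi>' W' g' where 2: "(V', \<psi>') \<in> \<B>" "g p \<in> V'" "open W'" "p \<in> W'" "Cinf_on W' g'"
    "\<And>q. q \<in> X \<Longrightarrow> q \<in> W' \<Longrightarrow> g q \<in> V' \<and> \<psi>' (g q) = g' q"
    using g p by (force simp: smooth_map_on_def euclidean_atlas_def)
  have "Cinf_on (W \<inter> W') (\<lambda>x. (f' x, g' x))"
    using 1 2 by (intro Cinf_intros) (auto intro: Cinf_on_subset[where W = W] Cinf_on_subset[where W = W'])
  moreover have "(V \<times> V', map_prod \<psi> \<psi>') \<in> prod_atlas \<A> \<B>"
    using 1(1) 2(1) by (auto simp: prod_atlas_def)
  ultimately show "\<exists>(U, \<phi>)\<in>euclidean_atlas. \<exists>(V, \<psi>)\<in>prod_atlas \<A> \<B>.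
      p \<in> U \<and> (f p, g p) \<in> V \<and>
      (\<exists>W h. open W \<and> \<phi> p \<in> W \<and> W \<subseteq> \<phi> ` U \<and> Cinf_on W h \<and>
        (\<forall>q\<in>X \<inter> U. \<phi> q \<in> W \<longrightarrow> (f q, g q) \<in> V \<and> \<psi> (f q, g q) = h (\<phi> q)))"
    using 1 2
    by (intro bexI[of _ "(UNIV, \<lambda>x. x)"] case_prodI
        bexI[of _ "(V \<times> V', map_prod \<psi> \<psi>')"] conjI exI[of _ "W \<inter> W'"] exI[of _ "\<lambda>x. (f' x, g' x)"])
      (auto simp: euclidean_atlas_def)
qed

text \<open>The open set for the product is a full cylinder over W. It must lie in the image of the
  chart domain, hence the demand for charts of the second factor that are onto the coordinate
  space.\<close>

lemma smooth_map_on_fst: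
  assumes f: "smooth_map_on \<A> UNIV \<C> f"
    and cover: "\<And>b. \<exists>(V, \<psi>)\<in>\<B>. b \<in> V \<and> \<psi> ` V = UNIV"
  shows "smooth_map_on (prod_atlas \<A> \<B>) X \<C> (\<lambda>x. f (fst x))"
  unfolding smooth_map_on_def
proof
  fix p assume p: "p \<in> X"
  obtain U \<phi> V \<psi> W f' where 1: "(U, \<phi>) \<in> \<A>" "(V, \<psi>) \<in> \<C>" "fst p \<in> U" "f (fst p) \<in> V" "open W" "\<phi> (fst p) \<in> W"
    "W \<subseteq> \<phi> ` U" "Cinf_on W f'" "\<And>q. q \<in> U \<Longrightarrow> \<phi> q \<in> W \<Longrightarrow> f q \<in> V \<and> \<psi> (f q) = f' (\<phi> q)"
    using bspec[OF f[unfolded smooth_map_on_def] UNIV_I, of "fst p"] by (elim bexE exE conjE case_prodE) blast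
  obtain U' \<phi>' where 2: "(U', \<phi>') \<in> \<B>" "snd p \<in> U'" "\<phi>' ` U' = UNIV"
    using cover[of "snd p"] by blast
  have "Cinf_on (fst -` W) (\<lambda>x. f' (fst x))"
    using 1 by (simp add: Cinf_on_def Ck_on_comp_linear bounded_linear_fst)
  moreover have "(U \<times> U', map_prod \<phi> \<phi>') \<in> prod_atlas \<A> \<B>"
    using 1(1) 2(1) by (auto simp: prod_atlas_def)
  moreover have "open (fst -` W)"
    using 1(5) by (rule open_vimage_fst)
  moreover have "fst -` W \<subseteq> map_prod \<phi> \<phi>' ` (U \<times> U')"
    using 1(7) 2(3) by (auto simp: map_prod_surj_on[OF refl refl])
  ultimately show "\<exists>(U, \<phi>)\<in>prod_atlas \<A> \<B>. \<exists>(V, \<psi>)\<in>\<C>.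
      p \<in> U \<and> f (fst p) \<in> V \<and>
      (\<exists>W h. open W \<and> \<phi> p \<in> W \<and> W \<subseteq> \<phi> ` U \<and> Cinf_on W h \<and>
        (\<forall>q\<in>X \<inter> U. \<phi> q \<in> W \<longrightarrow> f (fst q) \<in> V \<and> \<psi> (f (fst q)) = h (\<phi> q)))"
    using 1 2
    by (intro bexI[of _ "(U \<times> U', map_prod \<phi> \<phi>')"] case_prodI
        bexI[of _ "(V, \<psi>)"] conjI exI[of _ "fst -` W"] exI[of _ "\<lambda>x. f' (fst x)"])
      (auto simp: mem_Times_iff)
qed

lemma chart_onto_prod:
  assumes "\<And>a. \<exists>(U, \<phi>)\<in>\<A>. a \<in> U \<and> \<phi> ` U = UNIV" "\<And>b. \<exists>(V, \<psi>)\<in>\<B>. b \<in> V \<and> \<psi> ` V = UNIV"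
  shows "\<exists>(W, \<theta>)\<in>prod_atlas \<A> \<B>. p \<in> W \<and> \<theta> ` W = UNIV"
proof -
  obtain U \<phi> where "(U, \<phi>) \<in> \<A>" "fst p \<in> U" "\<phi> ` U = UNIV"
    using assms(1)[of "fst p"] by blast
  moreover obtain V \<psi> where "(V, \<psi>) \<in> \<B>" "snd p \<in> V" "\<psi> ` V = UNIV"
    using assms(2)[of "snd p"] by blast
  ultimately show ?thesis
    by (intro bexI[of _ "(U \<times> V, map_prod \<phi> \<psi>)"])
      (auto simp: prod_atlas_def mem_Times_iff map_prod_surj_on[OF refl refl])
qed

lemma range_the: "the ` (- {None}) = UNIV"
  by (metis ComplI UNIV_eq_I image_eqI option.distinct(1) option.sel singletonD)

lemma range_inf_chart: "inf_chart ` (- {Some 0}) = UNIV"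
proof (rule UNIV_eq_I[symmetric])
  show "t \<in> inf_chart ` (- {Some 0})" for t
    by (cases "t = 0") (auto intro: image_eqI[of _ _ None] image_eqI[of _ _ "Some (1 / t)"])
qed

lemma chart_onto_rext: "\<exists>(U, \<phi>)\<in>rext_atlas. x \<in> U \<and> \<phi> ` U = UNIV"
  by (cases x) (auto simp: rext_atlas_def range_the range_inf_chart)

section \<open>The projective line and the unit circle\<close>

text \<open>The point [p : q] of the projective line in homogeneous coordinates. The meaningless
  pair [0 : 0] is also sent to \<open>None\<close>.\<close>

definition ratio :: "real \<Rightarrow> real \<Rightarrow> rext" where
  "ratio p q = (if q = 0 then None else Some (p / q))"

text \<open>The representing pair may vary with the point v. If \<open>q v\<close> is nonzero, p/q
  expresses f in the coordinate x near v; otherwise \<open>p v\<close> is nonzero and q/p expresses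
  f in the coordinate 1/x, with value 0 at \<infinity>.\<close>

lemma smooth_map_on_ratio:
  fixes X :: "'a::euclidean_space set"
  assumes "\<And>v. v \<in> X \<Longrightarrow> \<exists>p q. Cinf_on UNIV p \<and> Cinf_on UNIV q \<and> (p v \<noteq> 0 \<or> q v \<noteq> 0) \<and>
     (\<forall>u\<in>X. p u \<noteq> 0 \<or> q u \<noteq> 0 \<longrightarrow> f u = ratio (p u) (q u))"
  shows "smooth_map_on euclidean_atlas X rext_atlas f"
  unfolding smooth_map_on_def
proof
  fix v assume v: "v \<in> X"
  obtain p q where pq: "Cinf_on UNIV p" "Cinf_on UNIV q" "p v \<noteq> 0 \<or> q v \<noteq> 0"
    "\<And>u. u \<in> X \<Longrightarrow> p u \<noteq> 0 \<or> q u \<noteq> 0 \<Longrightarrow> f u = ratio (p u) (q u)"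
    using assms[OF v] by blast
  have op: "open {u. r u \<noteq> 0}" if "Cinf_on UNIV r" for r :: "'a \<Rightarrow> real"
  proof -
    have "Ck_on 0 UNIV r" using that unfolding Cinf_on_def by blast
    then show ?thesis by (intro open_Collect_neq) auto
  qed
  have Cq: "Cinf_on {u. q u \<noteq> 0} (\<lambda>u. p u / q u)" and Cp: "Cinf_on {u. p u \<noteq> 0} (\<lambda>u. q u / p u)"
    using pq op by (auto intro!: Cinf_intros intro: Cinf_on_subset[OF _ subset_UNIV])
  show "\<exists>(U, \<phi>)\<in>euclidean_atlas. \<exists>(V, \<psi>)\<in>rext_atlas. v \<in> U \<and> f v \<in> V \<and>
      (\<exists>W g. open W \<and> \<phi> v \<in> W \<and> W \<subseteq> \<phi> ` U \<and> Cinf_on W g \<and>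
        (\<forall>u\<in>X \<inter> U. \<phi> u \<in> W \<longrightarrow> f u \<in> V \<and> \<psi> (f u) = g (\<phi> u)))"
  proof (cases "q v = 0")
    case False
    then show ?thesis
      using pq op Cq v
      by (intro bexI[of _ "(UNIV, \<lambda>x. x)"] bexI[of _ "(- {None}, the)"] case_prodI conjI
          exI[of _ "{u. q u \<noteq> 0}"] exI[of _ "\<lambda>u. p u / q u"])
        (auto simp: euclidean_atlas_def rext_atlas_def ratio_def)
  next
    case True
    then show ?thesis
      using pq op Cp v
      by (intro bexI[of _ "(UNIV, \<lambda>x. x)"] bexI[of _ "(- {Some 0}, inf_chart)"] case_prodI conjI
          exI[of _ "{u. p u \<noteq> 0}"] exI[of _ "\<lambda>u. q u / p u"])
        (auto simp: euclidean_atlas_def rext_atlas_def ratio_def)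
  qed
qed

section \<open>The Cayley transform between the extended line and the unit circle\<close>

fun cayley :: "rext \<Rightarrow> complex" where
  "cayley None = -1"
| "cayley (Some t) = (1 + \<i> * of_real t) / (1 - \<i> * of_real t)"

text \<open>This is tan(t/2) = sin t / (1 + cos t) for v = e^(it). At v = -1 the pair is [0 : 0],
  and the default of \<open>ratio\<close> supplies the correct value \<open>None\<close>.\<close>

definition cayley_inv :: "complex \<Rightarrow> rext" where
  "cayley_inv v = ratio (Im v) (1 + Re v)"

lemma of_real_minus_imaginary_eq_0_iff: "of_real q - \<i> * of_real p = 0 \<longleftrightarrow> p = 0 \<and> q = 0"
  by (auto simp: complex_eq_iff)

text \<open>Homogeneous form of the transform, obtained by clearing q. For q = 0 it reads ip / (-ip)
  = -1, the value at \<infinity>, so later arguments need no separate case.\<close>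

lemma cayley_ratio:
  assumes "p \<noteq> 0 \<or> q \<noteq> 0"
  shows "cayley (ratio p q) = (of_real q + \<i> * of_real p) / (of_real q - \<i> * of_real p)"
proof (cases "q = 0")
  case False
  then show ?thesis
    using of_real_minus_imaginary_eq_0_iff[of q p] of_real_minus_imaginary_eq_0_iff[of 1 "p / q"]
    by (simp add: ratio_def field_simps)
qed (use assms in \<open>simp add: ratio_def\<close>)

lemma unit_circle_iff: "v \<in> sphere 0 1 \<longleftrightarrow> (Re v)\<^sup>2 + (Im v)\<^sup>2 = 1"
  by (simp add: cmod_def)

lemma Re_Im_cayley_Some:
  "Re (cayley (Some t)) = (1 - t\<^sup>2) / (1 + t\<^sup>2)" "Im (cayley (Some t)) = 2 * t / (1 + t\<^sup>2)"
  by (simp_all add: Re_divide Im_divide power2_eq_square)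

lemma cayley_in_circle: "cayley x \<in> sphere 0 1"
proof (cases x)
  case (Some t)
  have "1 + t\<^sup>2 \<noteq> 0" by (smt (verit) zero_le_power2)
  then have "((1 - t\<^sup>2) / (1 + t\<^sup>2))\<^sup>2 + (2 * t / (1 + t\<^sup>2))\<^sup>2 = 1"
    by (simp add: field_simps) (simp add: power2_eq_square algebra_simps)
  then show ?thesis
    unfolding unit_circle_iff Some Re_Im_cayley_Some .
qed simp

lemma cayley_inv_cayley: "cayley_inv (cayley x) = x"
proof (cases x)
  case (Some t)
  have "1 + t\<^sup>2 \<noteq> 0" by (smt (verit) zero_le_power2)
  then have "1 + (1 - t\<^sup>2) / (1 + t\<^sup>2) = 2 / (1 + t\<^sup>2)"
    by (simp add: field_simps)
  then show ?thesis
    using \<open>1 + t\<^sup>2 \<noteq> 0\<close> unfolding cayley_inv_def ratio_def Some Re_Im_cayley_Some by simp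
qed (simp add: cayley_inv_def ratio_def)

lemma inj_cayley: "cayley x = cayley y \<longleftrightarrow> x = y"
  by (metis cayley_inv_cayley)

lemma unit_circle_Re_minus_one: "v \<in> sphere 0 1 \<Longrightarrow> Re v = -1 \<Longrightarrow> v = -1"
  by (simp only: unit_circle_iff) (auto simp: complex_eq_iff)

lemma cayley_cayley_inv:
  assumes "v \<in> sphere 0 1"
  shows "cayley (cayley_inv v) = v"
proof (cases "Re v = -1")
  case True
  then show ?thesis
    using unit_circle_Re_minus_one[OF assms] by (simp add: cayley_inv_def ratio_def)
next
  case False
  \<comment> \<open>This is (1 + \<open>cnj v\<close>) v = 1 + v, valid because v times its
    conjugate is 1.\<close>
  have "(1 + Re v - \<i> * Im v) * v = 1 + Re v + \<i> * Im v"
    using assms unfolding unit_circle_iff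
    by (auto simp: complex_eq_iff power2_eq_square algebra_simps)
  moreover have "1 + Re v - \<i> * Im v \<noteq> 0"
    using False by (auto simp: complex_eq_iff)
  ultimately have "(1 + Re v + \<i> * Im v) / (1 + Re v - \<i> * Im v) = v"
    by (metis nonzero_mult_div_cancel_left)
  moreover have "cayley (cayley_inv v) = (1 + Re v + \<i> * Im v) / (1 + Re v - \<i> * Im v)"
    using False cayley_ratio[of "Im v" "1 + Re v"] by (simp add: cayley_inv_def)
  ultimately show ?thesis by simp
qed

lemma cayley_uminus: "cayley (map_option uminus x) = cnj (cayley x)"
  by (cases x) auto

lemma smooth_cayley: "smooth_map_on rext_atlas UNIV euclidean_atlas cayley"
  unfolding smooth_map_on_def
proof
  fix x :: rext
  have C: "Cinf_on UNIV (\<lambda>t. (1 + \<i> * of_real t) / (1 - \<i> * of_real t))"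
    "Cinf_on UNIV (\<lambda>t. (of_real t + \<i>) / (of_real t - \<i>))"
    by (intro Cinf_intros; auto simp: complex_eq_iff)+
  have 1: "cayley q = (1 + \<i> * of_real (the q)) / (1 - \<i> * of_real (the q))" if "q \<noteq> None" for q
    using that by auto
  \<comment> \<open>In the coordinate s = 1/t the transform is (s + i)/(s - i), which also gives -1
    at s = 0.\<close>
  have 2: "cayley q = (of_real (inf_chart q) + \<i>) / (of_real (inf_chart q) - \<i>)" if "q \<noteq> Some 0" for q
  proof (cases q)
    case (Some t)
    then show ?thesis
      using that cayley_ratio[of t 1] cayley_ratio[of 1 "1 / t"] by (simp add: ratio_def)
  qed simp
  show "\<exists>(U, \<phi>)\<in>rext_atlas. \<exists>(V, \<psi>)\<in>euclidean_atlas. x \<in> U \<and> cayley x \<in> V \<and>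
      (\<exists>W g. open W \<and> \<phi> x \<in> W \<and> W \<subseteq> \<phi> ` U \<and> Cinf_on W g \<and>
        (\<forall>q\<in>UNIV \<inter> U. \<phi> q \<in> W \<longrightarrow> cayley q \<in> V \<and> \<psi> (cayley q) = g (\<phi> q)))"
  proof (cases x)
    case (Some t)
    then show ?thesis
      using C(1) 1
      by (intro bexI[of _ "(- {None}, the)"] bexI[of _ "(UNIV, \<lambda>x. x)"] case_prodI conjI
          exI[of _ UNIV] exI[of _ "\<lambda>t. (1 + \<i> * of_real t) / (1 - \<i> * of_real t)"])
        (auto simp: euclidean_atlas_def rext_atlas_def range_the)
  next
    case None
    then show ?thesis
      using C(2) 2
      by (intro bexI[of _ "(- {Some 0}, inf_chart)"] bexI[of _ "(UNIV, \<lambda>x. x)"] case_prodI conjI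
          exI[of _ UNIV] exI[of _ "\<lambda>t. (of_real t + \<i>) / (of_real t - \<i>)"])
        (auto simp: euclidean_atlas_def rext_atlas_def range_inf_chart)
  qed
qed

text \<open>The diffeomorphism is the Cayley transform of the first coordinate, smooth on the whole
  ambient product. Its inverse lifts a point of the circle to the graph, so it only has to be smooth
  in each coordinate.\<close>

lemma diffeomorphic_circle_graph:
  assumes "\<And>F. F \<in> {Y, Z, W} \<Longrightarrow>
    smooth_map_on euclidean_atlas (sphere 0 1) rext_atlas (\<lambda>v. F (cayley_inv v))"
    and "smooth_map_on euclidean_atlas (sphere 0 1) rext_atlas cayley_inv"
  shows "diffeomorphic_circle {(x, Y x, Z x, W x) | x. x \<in> UNIV}" (is "diffeomorphic_circle ?X")
proof -
  define G where "G v = (cayley_inv v, Y (cayley_inv v), Z (cayley_inv v), W (cayley_inv v))" for v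
  have "smooth_map_on rext4_atlas ?X euclidean_atlas (\<lambda>p. cayley (fst p))"
    unfolding rext4_atlas_def
    by (intro smooth_map_on_fst smooth_cayley chart_onto_prod chart_onto_rext)
  moreover have "smooth_map_on euclidean_atlas (sphere 0 1) rext4_atlas G"
    unfolding rext4_atlas_def G_def by (intro smooth_map_on_Pair assms) auto
  ultimately show ?thesis
    unfolding diffeomorphic_def
    by (intro exI[of _ "\<lambda>p. cayley (fst p)"] exI[of _ G])
      (use cayley_in_circle in \<open>auto simp: G_def cayley_inv_cayley cayley_cayley_inv\<close>)
qed

text \<open>The coordinate \<open>Im v / (1 + Re v)\<close> degenerates at \<open>-1\<close>, where \<open>(1 - Re v) / Im v\<close> replaces it.\<close>

lemma cayley_inv_eq_ratio:
  assumes "v \<in> sphere 0 1" "v \<noteq> 1"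
  shows "cayley_inv v = ratio (1 - Re v) (Im v)"
proof -
  \<comment> \<open>The circle equation is the cross-multiplied form of [Im v : 1 + Re v] =
    [1 - Re v : Im v].\<close>
  have *: "(1 - Re v) * (1 + Re v) = Im v * Im v"
    using assms(1) unfolding unit_circle_iff by (simp add: power2_eq_square algebra_simps)
  moreover have "Re v = 1 \<Longrightarrow> Im v = 0"
    using * by simp
  then have "Re v \<noteq> 1"
    using assms(2) by (auto simp: complex_eq_iff)
  ultimately show ?thesis
    by (cases "1 + Re v = 0") (auto simp: cayley_inv_def ratio_def divide_eq_eq eq_divide_eq mult_ac)
qed

lemma smooth_cayley_inv:
  "smooth_map_on euclidean_atlas (sphere 0 1) rext_atlas cayley_inv" (is ?A)
  "smooth_map_on euclidean_atlas (sphere 0 1) rext_atlas (\<lambda>v. map_option uminus (cayley_inv v))" (is ?B)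
proof -
  have m: "map_option uminus (ratio p q) = ratio (- p) q" for p q
    by (simp add: ratio_def)
  have C: "Cinf_on UNIV (\<lambda>v. Im v)" "Cinf_on UNIV (\<lambda>v. - Im v)" "Cinf_on UNIV (\<lambda>v. 1 + Re v)"
    "Cinf_on UNIV (\<lambda>v. 1 - Re v)" "Cinf_on UNIV (\<lambda>v. - (1 - Re v))"
    by (intro Cinf_intros open_UNIV)+
  show ?A
  proof (rule smooth_map_on_ratio)
    fix v :: complex
    show "\<exists>p q. Cinf_on UNIV p \<and> Cinf_on UNIV q \<and> (p v \<noteq> 0 \<or> q v \<noteq> 0) \<and>
     (\<forall>u\<in>sphere 0 1. p u \<noteq> 0 \<or> q u \<noteq> 0 \<longrightarrow> cayley_inv u = ratio (p u) (q u))"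
    proof (cases "Re v = -1")
      case True
      show ?thesis
        by (rule exI[of _ "\<lambda>v. 1 - Re v"], rule exI[of _ Im])
          (use C True in \<open>auto intro: cayley_inv_eq_ratio\<close>)
    next
      case False
      show ?thesis
        by (rule exI[of _ Im], rule exI[of _ "\<lambda>v. 1 + Re v"])
          (use C False in \<open>auto simp: cayley_inv_def\<close>)
    qed
  qed
  \<comment> \<open>The sign passes to the numerator. On the circle the premise excludes just u = 1,
    where this pair would be [0 : 0].\<close>
  have e: "map_option uminus (cayley_inv u) = ratio (- (1 - Re u)) (Im u)"
    if "u \<in> sphere 0 1" "- (1 - Re u) \<noteq> 0 \<or> Im u \<noteq> 0" for u
  proof -
    have "u \<noteq> 1" using that(2) by auto
    show ?thesis unfolding cayley_inv_eq_ratio[OF that(1) \<open>u \<noteq> 1\<close>] m ..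
  qed
  show ?B
  proof (rule smooth_map_on_ratio)
    fix v :: complex
    show "\<exists>p q. Cinf_on UNIV p \<and> Cinf_on UNIV q \<and> (p v \<noteq> 0 \<or> q v \<noteq> 0) \<and>
     (\<forall>u\<in>sphere 0 1. p u \<noteq> 0 \<or> q u \<noteq> 0 \<longrightarrow> map_option uminus (cayley_inv u) = ratio (p u) (q u))"
    proof (cases "Re v = -1")
      case True
      show ?thesis
        by (rule exI[of _ "\<lambda>v. - (1 - Re v)"], rule exI[of _ Im])
          (use C True e in \<open>simp del: minus_diff_eq mem_sphere\<close>)
    next
      case False
      show ?thesis
        by (rule exI[of _ "\<lambda>v. - Im v"], rule exI[of _ "\<lambda>v. 1 + Re v"])
          (use C False in \<open>auto simp: cayley_inv_def m\<close>)
    qed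
  qed
qed

section \<open>Configurations of the deltoid\<close>

text \<open>Away from \<pi> the half tangent is [sin(\<rho>/2) : cos(\<rho>/2)], whose transform is
  e^(i\<rho>/2) / e^(-i\<rho>/2).\<close>

lemma cayley_half_tan: "cayley (half_tan \<rho>) = cis \<rho>"
proof (cases "[\<rho> = pi] (rmod (2 * pi))")
  case True
  then obtain k :: int where "\<rho> = pi + 2 * pi * of_int k"
    unfolding rcong_altdef by (metis add_diff_cancel_right' minus_add_cancel mult.commute mult_minus_left of_int_minus uminus_add_conv_diff)
  then have "cis \<rho> = -1"
    by (simp add: cis_mult[symmetric] cis_multiple_2pi)
  then show ?thesis using True by (simp add: half_tan_def)
next
  case False
  have "cos (\<rho> / 2) \<noteq> 0"
  proof
    assume "cos (\<rho> / 2) = 0"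
    then have "cis \<rho> = -1"
      using cos_double_cos[of "\<rho> / 2"] sin_double[of "\<rho> / 2"] by (simp add: complex_eq_iff)
    then have "cis \<rho> = cis pi" by simp
    then show False using False unfolding cis_eq_iff by blast
  qed
  then have "half_tan \<rho> = ratio (sin (\<rho> / 2)) (cos (\<rho> / 2))"
    using False by (simp add: half_tan_def ratio_def tan_def)
  moreover have "(cos (\<rho> / 2) - \<i> * sin (\<rho> / 2)) * cis \<rho> = cos (\<rho> / 2) + \<i> * sin (\<rho> / 2)"
  proof -
    have "cis (- (\<rho> / 2)) * cis \<rho> = cis (\<rho> / 2)" by (simp add: cis_mult)
    moreover have "cis (- (\<rho> / 2)) = cos (\<rho> / 2) - \<i> * sin (\<rho> / 2)"
      "cis (\<rho> / 2) = cos (\<rho> / 2) + \<i> * sin (\<rho> / 2)"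
      by (simp_all add: complex_eq_iff)
    ultimately show ?thesis by simp
  qed
  moreover have "of_real (cos (\<rho> / 2)) - \<i> * of_real (sin (\<rho> / 2)) \<noteq> 0"
    using \<open>cos (\<rho> / 2) \<noteq> 0\<close> unfolding of_real_minus_imaginary_eq_0_iff by simp
  ultimately show ?thesis
    using \<open>cos (\<rho> / 2) \<noteq> 0\<close> by (simp add: cayley_ratio field_simps)
qed

lemma half_tan_surj: "\<exists>\<rho>. half_tan \<rho> = x"
proof -
  obtain \<rho> where "cayley x = cis \<rho>"
    using cayley_in_circle[of x] by (metis cis_Arg dist_0_norm mem_sphere norm_zero sgn_eq zero_neq_one div_by_1 of_real_1)
  then show ?thesis
    by (metis cayley_half_tan inj_cayley)
qed

text \<open>The conditions depend on the angles only through \<open>cis\<close>, hence only through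
  the half tangents. Any angles with the given half tangents therefore decide membership, and
  surjectivity supplies some.\<close>

lemma configurations_iff:
  "(x, y, z, w) \<in> configurations \<alpha> \<beta> \<gamma> \<delta> \<longleftrightarrow>
     cayley x * cayley y * cayley z * cayley w = 1 \<and>
     of_real \<beta> + of_real \<gamma> * cayley y + of_real \<delta> * (cayley y * cayley z)
       + of_real \<alpha> * (cayley y * cayley z * cayley w) = 0"
proof -
  have ang: "is_angle_config \<alpha> \<beta> \<gamma> \<delta> a b c d \<longleftrightarrow> cis a * cis b * cis c * cis d = 1 \<and>
     of_real \<beta> + of_real \<gamma> * cis b + of_real \<delta> * (cis b * cis c)
       + of_real \<alpha> * (cis b * cis c * cis d) = 0" for a b c d
    using cis_eq_iff[of "a + b + c + d" 0] by (simp add: is_angle_config_def cis_mult)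
  obtain a b c d where "x = half_tan a" "y = half_tan b" "z = half_tan c" "w = half_tan d"
    using half_tan_surj by metis
  then show ?thesis
    unfolding configurations_def
    by (auto simp: ang cayley_half_tan[symmetric])
qed

section \<open>The closure equation for unit complex numbers\<close>

lemma cnj_unit: "v \<in> sphere 0 1 \<Longrightarrow> v * cnj v = 1"
  by (simp add: complex_norm_square[symmetric])

text \<open>The two terms have the different moduli \<beta> and \<alpha>, so they cannot cancel.
  Here the assumption of distinct bar lengths enters.\<close>

lemma bar_sum_nonzero:
  fixes v :: complex
  assumes "\<alpha> > 0" "\<beta> > 0" "\<beta> \<noteq> \<alpha>" "v \<in> sphere 0 1"
  shows "of_real \<beta> + of_real \<alpha> * v \<noteq> 0"
proof
  assume "of_real \<beta> + of_real \<alpha> * v = 0"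
  then have "norm (of_real \<beta> :: complex) = norm (of_real \<alpha> * v)"
    by (metis add_eq_0_iff norm_minus_cancel)
  then show False using assms by (simp add: norm_mult)
qed

lemma deltoid_closure_iff:
  fixes a b c d :: complex
  assumes "\<alpha> > 0" "\<beta> > 0" "\<beta> \<noteq> \<alpha>"
    and circ: "a \<in> sphere 0 1" "b \<in> sphere 0 1" "c \<in> sphere 0 1" "d \<in> sphere 0 1"
  shows "a * b * c * d = 1 \<and>
      of_real \<beta> + of_real \<beta> * b + of_real \<alpha> * (b * c) + of_real \<alpha> * (b * c * d) = 0 \<longleftrightarrow>
    c = a \<and> b * (of_real \<beta> + of_real \<alpha> * a) = - (of_real \<beta> + of_real \<alpha> * cnj a)
      \<and> d * (of_real \<alpha> + of_real \<beta> * a) = - (of_real \<alpha> + of_real \<beta> * cnj a)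
    \<or> b = -1 \<and> c = cnj a \<and> d = -1" (is "?L \<longleftrightarrow> ?R1 \<or> ?R2")
proof
  let ?A = "of_real \<alpha> :: complex" and ?B = "of_real \<beta> :: complex"
  note unit = circ[THEN cnj_unit]
  have nz: "?A \<noteq> 0" "?B \<noteq> 0" using assms by auto
  show "?R1 \<or> ?R2" if ?L
  proof -
    have prod: "a * b * c * d = 1"
      and cl0: "?B + ?B * b + ?A * (b * c) + ?A * (b * c * d) = 0"
      using that by blast+
    have bcd: "b * c * d = cnj a" using prod unit(1) by algebra
    have cl: "?B * (1 + b) + ?A * (b * c + cnj a) = 0"
      using cl0 unfolding bcd by (simp add: algebra_simps)
    have "cnj (?B * (1 + b) + ?A * (b * c + cnj a)) = 0" by (simp only: cl complex_cnj_zero)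
    then have "?B * (1 + cnj b) + ?A * (cnj b * cnj c + a) = 0" by simp
    \<comment> \<open>The conjugate equation multiplied by b, using b \<open>cnj b\<close> =
      1.\<close>
    then have "?B * (1 + b) + ?A * (cnj c + a * b) = 0"
      using unit(2) by algebra
    then have "?A * (b * c + cnj a) = ?A * (cnj c + a * b)"
      using cl by algebra
    then have eq: "b * c + cnj a = cnj c + a * b" using nz by simp
    \<comment> \<open>Multiplying \<open>eq\<close> by a c removes the conjugates, and the
      difference of the two sides factors.\<close>
    have "(c - a) * (a * b * c + 1) = 0"
      using eq unit(1,3) by algebra
    then consider "c = a" | "a * b * c = -1"
      by (auto simp: add_eq_0_iff2)
    then show ?thesis
    proof cases
      case 1
      have "b * (?B + ?A * a) = - (?B + ?A * cnj a)"
        using cl 1 by algebra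
      \<comment> \<open>Multiply the equation for b by a d: since c = a, the product condition gives
        a b d = \<open>cnj a\<close>.\<close>
      moreover have "d * (?A + ?B * a) = - (?A + ?B * cnj a)"
        using cl 1 prod unit(1) by algebra
      ultimately show ?thesis using 1 by simp
    next
      case 2
      then have d: "d = -1" using prod by algebra
      then have "?B * (1 + b) = 0" using cl0 by (simp add: algebra_simps)
      then have "b = -1" using nz by (simp add: add_eq_0_iff)
      moreover have "c = cnj a" using 2 \<open>b = -1\<close> unit(1) by algebra
      ultimately show ?thesis using d by simp
    qed
  qed
  show ?L if "?R1 \<or> ?R2"
    using that
  proof
    assume R: ?R1
    have n: "?B + ?A * a \<noteq> 0" "?A + ?B * a \<noteq> 0"
      using assms(1-3) circ(1) bar_sum_nonzero[of \<alpha> \<beta> a] bar_sum_nonzero[of \<beta> \<alpha> a] by blast+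
    \<comment> \<open>The product of both equations, times a^2. One factor a clears each conjugate
      on the right, leaving the same nonzero factors as on the left; cancelling them yields the
      product condition.\<close>
    have "b * (?B + ?A * a) * (d * (?A + ?B * a)) * (a * a) = (- (?B + ?A * cnj a)) * (- (?A + ?B * cnj a)) * (a * a)"
      using R by simp
    also have "\<dots> = (?B + ?A * a) * (?A + ?B * a)"
      using unit(1) by algebra
    finally have "(a * b * a * d) * ((?B + ?A * a) * (?A + ?B * a)) = 1 * ((?B + ?A * a) * (?A + ?B * a))"
      by (simp add: algebra_simps)
    then have prod: "a * b * a * d = 1" using n by simp
    then have "b * a * d = cnj a" using unit(1) by algebra
    then show ?L using R prod by (simp add: algebra_simps)
  qed (use unit in \<open>auto simp: algebra_simps\<close>)
qed

text \<open>With v = c + is one has x = s/(1+c) and x^2 = (1-c)/(1+c); multiplying numerator and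
  denominator of the coordinate by 1+c gives 2(\<beta> + \<alpha>c) and 2\<alpha>s. For s = 0, that
  is x = 0 or x = \<infinity>, both sides are \<open>None\<close>.\<close>

lemma deltoid_coord_cayley_inv:
  assumes "\<alpha> > 0" "v \<in> sphere 0 1"
  shows "deltoid_coord \<alpha> \<beta> (cayley_inv v) = ratio (\<beta> + \<alpha> * Re v) (\<alpha> * Im v)"
proof -
  define c s where "c = Re v" "s = Im v"
  have cs: "s\<^sup>2 = (1 - c) * (1 + c)"
    using assms(2) unfolding unit_circle_iff c_s_def by (simp add: power2_eq_square algebra_simps)
  show ?thesis
  proof (cases "c = -1 \<or> s = 0")
    case True
    then show ?thesis using cs
      by (auto simp: cayley_inv_def ratio_def c_s_def[symmetric])
  next
    case False
    then have nz: "1 + c \<noteq> 0" "s \<noteq> 0" by auto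
    have "(s / (1 + c))\<^sup>2 = (1 - c) / (1 + c)"
      using nz cs by (simp add: power_divide power2_eq_square)
    then have "((\<beta> - \<alpha>) * (s / (1 + c))\<^sup>2 + (\<beta> + \<alpha>)) / (2 * \<alpha> * (s / (1 + c)))
        = (\<beta> + \<alpha> * c) / (\<alpha> * s)"
      using nz assms(1) by (simp add: divide_simps) algebra
    then show ?thesis
      using nz assms(1) by (simp add: cayley_inv_def ratio_def c_s_def[symmetric])
  qed
qed

lemma deltoid_ratio_nonzero:
  assumes "\<alpha> > 0" "\<beta> > 0" "\<beta> \<noteq> \<alpha>" "v \<in> sphere 0 1"
  shows "\<beta> + \<alpha> * Re v \<noteq> 0 \<or> \<alpha> * Im v \<noteq> 0"
  using bar_sum_nonzero[OF assms] by (auto simp: complex_eq_iff)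

text \<open>With D = \<beta> + \<alpha>a the coordinate is [Re D : Im D]. Its transform is i
  \<open>cnj D\<close> / (-iD) = -\<open>cnj D\<close> / D, precisely the solution of the equation
  for \<open>cayley y\<close>.\<close>

lemma deltoid_coord_iff:
  assumes "\<alpha> > 0" "\<beta> > 0" "\<beta> \<noteq> \<alpha>"
  shows "cayley y * (of_real \<beta> + of_real \<alpha> * cayley x) = - (of_real \<beta> + of_real \<alpha> * cnj (cayley x))
    \<longleftrightarrow> y = deltoid_coord \<alpha> \<beta> x"
proof -
  define a where "a = cayley x"
  define D where "D = of_real \<beta> + of_real \<alpha> * a"
  have a: "a \<in> sphere 0 1" unfolding a_def by (rule cayley_in_circle)
  have D: "D \<noteq> 0" unfolding D_def by (rule bar_sum_nonzero) (fact assms a)+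
  have cD: "cnj D = of_real \<beta> + of_real \<alpha> * cnj a" by (simp add: D_def)
  have "deltoid_coord \<alpha> \<beta> x = ratio (\<beta> + \<alpha> * Re a) (\<alpha> * Im a)"
    using deltoid_coord_cayley_inv[OF assms(1) a] by (simp add: a_def cayley_inv_cayley)
  then have "cayley (deltoid_coord \<alpha> \<beta> x) = (of_real (\<alpha> * Im a) + \<i> * of_real (\<beta> + \<alpha> * Re a)) /
      (of_real (\<alpha> * Im a) - \<i> * of_real (\<beta> + \<alpha> * Re a))"
    by (simp only: cayley_ratio[OF deltoid_ratio_nonzero[OF assms a]])
  also have "of_real (\<alpha> * Im a) + \<i> * of_real (\<beta> + \<alpha> * Re a) = \<i> * cnj D"
    by (simp add: D_def complex_eq_iff)
  also have "of_real (\<alpha> * Im a) - \<i> * of_real (\<beta> + \<alpha> * Re a) = - (\<i> * D)"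
    by (simp add: D_def complex_eq_iff)
  finally have "cayley (deltoid_coord \<alpha> \<beta> x) = - cnj D / D" by simp
  then have "y = deltoid_coord \<alpha> \<beta> x \<longleftrightarrow> cayley y = - cnj D / D"
    by (metis inj_cayley)
  then show ?thesis
    using D unfolding a_def[symmetric] cD[symmetric] D_def[symmetric] by (simp add: field_simps)
qed

text \<open>Numerator and denominator are the real and imaginary parts of a sum that never vanishes
  on the circle, so one pair serves at every point.\<close>

lemma smooth_deltoid_coord:
  assumes "\<alpha> > 0" "\<beta> > 0" "\<beta> \<noteq> \<alpha>"
  shows "smooth_map_on euclidean_atlas (sphere 0 1) rext_atlas (\<lambda>v. deltoid_coord \<alpha> \<beta> (cayley_inv v))"
proof (rule smooth_map_on_ratio)
  fix v :: complex assume v: "v \<in> sphere 0 1"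
  have "Cinf_on UNIV (\<lambda>v. \<beta> + \<alpha> * Re v)" "Cinf_on UNIV (\<lambda>v. \<alpha> * Im v)"
    by (intro Cinf_intros open_UNIV)+
  note C = this
  show "\<exists>p q. Cinf_on UNIV p \<and> Cinf_on UNIV q \<and> (p v \<noteq> 0 \<or> q v \<noteq> 0) \<and>
     (\<forall>u\<in>sphere 0 1. p u \<noteq> 0 \<or> q u \<noteq> 0 \<longrightarrow> deltoid_coord \<alpha> \<beta> (cayley_inv u) = ratio (p u) (q u))"
    by (rule exI[of _ "\<lambda>v. \<beta> + \<alpha> * Re v"], rule exI[of _ "\<lambda>v. \<alpha> * Im v"])
      (intro conjI ballI impI C deltoid_ratio_nonzero[OF assms v] deltoid_coord_cayley_inv[OF assms(1)])
qed

theorem mainTheorem4: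
  fixes \<alpha> \<beta> \<gamma> \<delta> :: real
  assumes "\<alpha> > 0" and "\<beta> > 0" and "\<beta> \<noteq> \<alpha>"
    and "\<delta> = \<alpha>" and "\<gamma> = \<beta>"
  shows "configurations \<alpha> \<beta> \<gamma> \<delta> = deltoid_branch1 \<alpha> \<beta> \<union> deltoid_branch2
    \<and> diffeomorphic_circle (deltoid_branch1 \<alpha> \<beta>)
    \<and> diffeomorphic_circle deltoid_branch2"
proof (intro conjI)
  have "(x, y, z, w) \<in> configurations \<alpha> \<beta> \<gamma> \<delta> \<longleftrightarrow>
      (x, y, z, w) \<in> deltoid_branch1 \<alpha> \<beta> \<union> deltoid_branch2" for x y z w
  proof -
    have neg1: "cayley u = -1 \<longleftrightarrow> u = None" for u
      using inj_cayley[of u None] by simp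
    show ?thesis
      \<comment> \<open>The equation for d is that for b with \<alpha> and \<beta> exchanged, hence
        the second instance of \<open>deltoid_coord_iff\<close>. Conjugation and -1 then translate
        back to negation and \<open>None\<close>.\<close>
      unfolding configurations_iff assms(4,5)
        deltoid_closure_iff[OF assms(1-3) cayley_in_circle cayley_in_circle cayley_in_circle cayley_in_circle]
        deltoid_coord_iff[OF assms(1-3)] deltoid_coord_iff[OF assms(2,1) assms(3)[symmetric]]
      unfolding cayley_uminus[symmetric] inj_cayley neg1
      by (auto simp: deltoid_branch1_def deltoid_branch2_def)
  qed
  then show "configurations \<alpha> \<beta> \<gamma> \<delta> = deltoid_branch1 \<alpha> \<beta> \<union> deltoid_branch2"
    by auto
  show "diffeomorphic_circle (deltoid_branch1 \<alpha> \<beta>)"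
    unfolding deltoid_branch1_def
    by (rule diffeomorphic_circle_graph[where Z = "\<lambda>x. x"])
      (use assms(1-3) in \<open>auto intro: smooth_cayley_inv smooth_deltoid_coord\<close>)
  \<comment> \<open>The constant \<infinity> is the ratio [1 : 0].\<close>
  have "smooth_map_on euclidean_atlas (sphere (0::complex) 1) rext_atlas (\<lambda>v. None)"
    by (rule smooth_map_on_ratio, rule exI[of _ "\<lambda>_. 1"], rule exI[of _ "\<lambda>_. 0"])
      (simp add: Cinf_on_const ratio_def)
  then show "diffeomorphic_circle deltoid_branch2"
    unfolding deltoid_branch2_def
    by (intro diffeomorphic_circle_graph[where Y = "\<lambda>_. None" and W = "\<lambda>_. None"])
      (auto intro: smooth_cayley_inv)
qed

end
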